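(* Let $U=[U_n]\subset{}^*\mathbb R^k$ be an internal open subset ($U_n\subset\mathbb R^k$ open for each $n$) and let $f\in{}^*C^\infty(U,{}^*\mathbb R)$. Suppose $f$ is represented by a net of smooth functions $(f_n\colon U_n\to\mathbb R)$, that is, $f(z)=[f_n(z_n)]$ for any $z=[z_n]\in U$. Then the following hold for any $x,y\in U$ such that $(1-t)x+ty\in U$ for all $t\in{}^*[0,1]$. IVT: If $f(x)\ne f(y)$ then for any $r\in{}^*\mathbb R$ between $f(x)$ and $f(y)$ there exists $z\in U$ such that $f(z)=r$. MVT: There exists $c\in{}^*(0,1)$ such that $f(y)-f(x)=\nabla f((1-c)x+cy)\cdot(y-x)$. Here $\nabla=(\partial_1,\dots,\partial_k)$ is the gradient and $\cdot$ is the dot product.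
   Context: $\mathbb N$ is the set of nonnegative integers, $\mathcal U$ a fixed free ultrafilter on $\mathbb N$; "a.e." means for a set of $n$ belonging to $\mathcal U$. ${}^*\mathbb R=\mathbb R^{\mathbb N}/\{(x_n): x_n=0\text{ a.e.}\}$ with $[a_n]\le[b_n]$ iff $a_n\le b_n$ a.e.; $[x_n]$ denotes the class of a net, componentwise for vectors. For $V_n\subset\mathbb R^k$, $[V_n]=\{[x_n]\in{}^*\mathbb R^k:(x_n)\in\prod_nV_n\}$; ${}^*M=[V_n]$ with all $V_n=M$ for $M\subset\mathbb R^k$. ${}^*\mathbb R^k$ has the topology with basis the sets $[V_n]$ with all $V_n$ open. For $U\subset{}^*\mathbb R^k$ open, ${}^*C^\infty(U,{}^*\mathbb R)$ is the set of $f\colon U\to{}^*\mathbb R$ such that each $x\in U$ has a neighbourhood $V=[V_n]\subset U$ ($V_n$ open) and $C^\infty$ functions $g_n\colon V_n\to\mathbb R$ with $f(y)=[g_n(y_n)]$ for every $y=[y_n]\in V$ with $y_n\in V_n$; then $\partial_if(x)=[\partial_ig_n(x_n)]$ for $x=[x_n]$, $x_n\in V_n$ (independent of choices). *)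

theory Defs
  imports "HOL-Analysis.Analysis" "HOL-Algebra.QuotRing"
begin

text \<open>A set \<open>A\<close> of indices belongs to the ultrafilter iff \<open>eventually (\<lambda>n. n \<in> A) \<U>\<close>.
  The last conjunct makes the intersection of all members empty.\<close>

definition free_ultrafilter :: "nat filter \<Rightarrow> bool" where
  "free_ultrafilter \<U> \<longleftrightarrow>
     \<U> \<noteq> bot \<and>
     (\<forall>P. eventually P \<U> \<or> eventually (\<lambda>n. \<not> P n) \<U>) \<and>
     (\<forall>m. eventually (\<lambda>n. n \<noteq> m) \<U>)"

definition seq_ring :: "(nat \<Rightarrow> real) ring" where
  "seq_ring =
     \<lparr>carrier = UNIV, mult = (\<lambda>X Y n. X n * Y n), one = (\<lambda>n. 1),
      zero = (\<lambda>n. 0), add = (\<lambda>X Y n. X n + Y n)\<rparr>"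

definition null_seqs :: "nat filter \<Rightarrow> (nat \<Rightarrow> real) set" where
  "null_seqs \<U> = {X. eventually (\<lambda>n. X n = 0) \<U>}"

definition star_real :: "nat filter \<Rightarrow> (nat \<Rightarrow> real) set ring" where
  "star_real \<U> = seq_ring Quot null_seqs \<U>"

type_synonym hyperreal = "(nat \<Rightarrow> real) set"

definition cls :: "nat filter \<Rightarrow> (nat \<Rightarrow> real) \<Rightarrow> hyperreal" where
  "cls \<U> X = null_seqs \<U> +>\<^bsub>seq_ring\<^esub> X"

definition star_le :: "nat filter \<Rightarrow> hyperreal \<Rightarrow> hyperreal \<Rightarrow> bool" where
  "star_le \<U> a b \<longleftrightarrow>
     (\<exists>X Y. a = cls \<U> X \<and> b = cls \<U> Y \<and> eventually (\<lambda>n. X n \<le> Y n) \<U>)"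

lemma cring_seq_ring: "cring seq_ring"
proof (rule cringI)
  show "abelian_group seq_ring"
  proof (rule abelian_groupI)
    fix X assume "X \<in> carrier seq_ring"
    show "\<exists>Y\<in>carrier seq_ring. Y \<oplus>\<^bsub>seq_ring\<^esub> X = \<zero>\<^bsub>seq_ring\<^esub>"
      by (rule bexI[of _ "\<lambda>n. - X n"]) (auto simp: seq_ring_def)
  qed (auto simp: seq_ring_def algebra_simps)
  show "Group.comm_monoid seq_ring"
    by (rule comm_monoidI) (auto simp: seq_ring_def algebra_simps)
qed (auto simp: seq_ring_def algebra_simps)

lemma ideal_null_seqs: "ideal (null_seqs \<U>) seq_ring"
proof (rule idealI)
  interpret cring seq_ring by (rule cring_seq_ring)
  show "ring seq_ring" by (rule ring_axioms)
  have inv: "inv\<^bsub>add_monoid seq_ring\<^esub> X = (\<lambda>n. - X n)" for X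
    using minus_equality[of "\<lambda>n. - X n" X] by (simp add: seq_ring_def a_inv_def)
  show "subgroup (null_seqs \<U>) (add_monoid seq_ring)"
  proof (rule subgroup.intro)
    show "inv\<^bsub>add_monoid seq_ring\<^esub> X \<in> null_seqs \<U>" if "X \<in> null_seqs \<U>" for X
      using that unfolding inv by (simp add: null_seqs_def)
  qed (auto simp: null_seqs_def seq_ring_def elim: eventually_elim2)
qed (auto simp: null_seqs_def seq_ring_def elim: eventually_mono)

lemma cring_star_real: "cring (star_real \<U>)"
  unfolding star_real_def
  by (rule ideal.quotient_is_cring[OF ideal_null_seqs cring_seq_ring])

text \<open>Elements of the \<open>k\<close>-th power are \<open>k\<close>-tuples of classes; the class of a net of vectors is
  formed componentwise.\<close>

definition vcls :: "nat filter \<Rightarrow> (nat \<Rightarrow> real^'k) \<Rightarrow> hyperreal^'k" where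
  "vcls \<U> X = (\<chi> i. cls \<U> (\<lambda>n. X n $ i))"

definition vadd :: "nat filter \<Rightarrow> hyperreal^'k \<Rightarrow> hyperreal^'k \<Rightarrow> hyperreal^'k" where
  "vadd \<U> x y = (\<chi> i. x $ i \<oplus>\<^bsub>star_real \<U>\<^esub> y $ i)"

definition vdiff :: "nat filter \<Rightarrow> hyperreal^'k \<Rightarrow> hyperreal^'k \<Rightarrow> hyperreal^'k" where
  "vdiff \<U> x y = (\<chi> i. x $ i \<ominus>\<^bsub>star_real \<U>\<^esub> y $ i)"

definition vscale :: "nat filter \<Rightarrow> hyperreal \<Rightarrow> hyperreal^'k \<Rightarrow> hyperreal^'k" where
  "vscale \<U> a x = (\<chi> i. a \<otimes>\<^bsub>star_real \<U>\<^esub> x $ i)"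

definition vdot :: "nat filter \<Rightarrow> hyperreal^'k \<Rightarrow> hyperreal^'k \<Rightarrow> hyperreal" where
  "vdot \<U> x y = (\<Oplus>\<^bsub>star_real \<U>\<^esub>i\<in>(UNIV :: 'k set). x $ i \<otimes>\<^bsub>star_real \<U>\<^esub> y $ i)"

definition segment_pt ::
    "nat filter \<Rightarrow> hyperreal^'k \<Rightarrow> hyperreal^'k \<Rightarrow> hyperreal \<Rightarrow> hyperreal^'k" where
  "segment_pt \<U> x y t =
     vadd \<U> (vscale \<U> (\<one>\<^bsub>star_real \<U>\<^esub> \<ominus>\<^bsub>star_real \<U>\<^esub> t) x) (vscale \<U> t y)"

text \<open>Internal sets \<open>[V\<^sub>n]\<close>, for sets of vectors and for sets of reals. A net has to lie in
  \<open>V\<^sub>n\<close> for every \<open>n\<close>, so \<open>[V\<^sub>n]\<close> is empty as soon as one \<open>V\<^sub>n\<close> is.\<close>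

definition internal_vec :: "nat filter \<Rightarrow> (nat \<Rightarrow> (real^'k) set) \<Rightarrow> (hyperreal^'k) set" where
  "internal_vec \<U> V = {vcls \<U> X | X. \<forall>n. X n \<in> V n}"

definition internal :: "nat filter \<Rightarrow> (nat \<Rightarrow> real set) \<Rightarrow> hyperreal set" where
  "internal \<U> V = {cls \<U> X | X. \<forall>n. X n \<in> V n}"

definition star_set :: "nat filter \<Rightarrow> real set \<Rightarrow> hyperreal set" where
  "star_set \<U> M = internal \<U> (\<lambda>n. M)"

definition partial :: "'k \<Rightarrow> (real^'k \<Rightarrow> real) \<Rightarrow> real^'k \<Rightarrow> real" where
  "partial i g x = deriv (\<lambda>t. g (x + t *\<^sub>R axis i 1)) 0"

text \<open>Only meant for open \<open>S\<close>, where \<open>differentiable_on\<close> is differentiability at every point.\<close>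

primrec C_on :: "nat \<Rightarrow> (real^'k) set \<Rightarrow> (real^'k \<Rightarrow> real) \<Rightarrow> bool" where
  "C_on 0 S g \<longleftrightarrow> continuous_on S g"
| "C_on (Suc m) S g \<longleftrightarrow> g differentiable_on S \<and> (\<forall>i. C_on m S (partial i g))"

definition smooth_on :: "(real^'k) set \<Rightarrow> (real^'k \<Rightarrow> real) \<Rightarrow> bool" where
  "smooth_on S g \<longleftrightarrow> (\<forall>m. C_on m S g)"

definition smooth_rep ::
    "nat filter \<Rightarrow> (hyperreal^'k \<Rightarrow> hyperreal) \<Rightarrow> (nat \<Rightarrow> (real^'k) set) \<Rightarrow>
     (nat \<Rightarrow> real^'k \<Rightarrow> real) \<Rightarrow> bool" where
  "smooth_rep \<U> f V g \<longleftrightarrow>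
     (\<forall>n. open (V n) \<and> smooth_on (V n) (g n)) \<and>
     (\<forall>Y. (\<forall>n. Y n \<in> V n) \<longrightarrow> f (vcls \<U> Y) = cls \<U> (\<lambda>n. g n (Y n)))"

text \<open>The internal sets with open components form a basis of the topology, so it is enough to use
  them as neighbourhoods, and the condition below can only hold for open \<open>W\<close>.
  Functions are total; their values outside \<open>W\<close> are irrelevant.\<close>

definition star_smooth ::
    "nat filter \<Rightarrow> (hyperreal^'k) set \<Rightarrow> (hyperreal^'k \<Rightarrow> hyperreal) set" where
  "star_smooth \<U> W =
     {f \<in> W \<rightarrow> carrier (star_real \<U>).
        \<forall>x\<in>W. \<exists>V g. x \<in> internal_vec \<U> V \<and> internal_vec \<U> V \<subseteq> W \<and> smooth_rep \<U> f V g}"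

text \<open>The value is the common one obtained from all local representations around \<open>x\<close> and all
  representatives of \<open>x\<close>.\<close>

definition star_partial ::
    "nat filter \<Rightarrow> (hyperreal^'k) set \<Rightarrow> 'k \<Rightarrow> (hyperreal^'k \<Rightarrow> hyperreal) \<Rightarrow>
     hyperreal^'k \<Rightarrow> hyperreal" where
  "star_partial \<U> W i f x =
     (THE d. \<exists>V g X. internal_vec \<U> V \<subseteq> W \<and> smooth_rep \<U> f V g \<and>
        (\<forall>n. X n \<in> V n) \<and> x = vcls \<U> X \<and> d = cls \<U> (\<lambda>n. partial i (g n) (X n)))"

definition star_grad ::
    "nat filter \<Rightarrow> (hyperreal^'k) set \<Rightarrow> (hyperreal^'k \<Rightarrow> hyperreal) \<Rightarrow>
     hyperreal^'k \<Rightarrow> hyperreal^'k" where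
  "star_grad \<U> W f x = (\<chi> i. star_partial \<U> W i f x)"

end

theory Submission
  imports Defs
begin

text \<open>
  Both assertions are the classical theorems on a real segment, applied at each index.
  Write \<open>x\<close> and \<open>y\<close> as classes of nets \<open>X\<close> and \<open>Y\<close> with values in the \<open>U\<^sub>n\<close>. That the
  nonstandard segment lies in \<open>U\<close> forces the real segment from \<open>X n\<close> to \<open>Y n\<close> into
  \<open>U\<^sub>n n\<close> for almost all \<open>n\<close>: otherwise parameters \<open>T n\<close> chosen where the real segments leave
  would define a nonstandard parameter whose point lies outside \<open>U\<close>
  (\<open>eventually_segment_subset\<close>). For almost all \<open>n\<close> the classical theorems (\<open>segment_IVT\<close>,
  \<open>segment_MVT\<close>) then provide an intermediate point and an intermediate parameter, and the
  classes of these choices are the required \<open>z\<close> and \<open>c\<close>.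

  What links the mean value identity to the gradient of \<open>f\<close> itself is that this gradient,
  defined through arbitrary local representations, may be computed from \<open>f\<^sub>n\<close>
  (\<open>star_grad_eq\<close>). Two nets that represent \<open>f\<close> near a common point coincide, for almost all
  \<open>n\<close>, on the whole overlap of their domains (\<open>smooth_rep_eventually_eq\<close>), hence so do their
  partial derivatives. This and the statement on segments both rest on choosing a
  counterexample at each index where a universal statement fails
  (\<open>eventually_all_of_sequences\<close>).
\<close>

section \<open>Computing with classes of sequences\<close>

lemma cls_eq_iff: "cls \<U> X = cls \<U> Y \<longleftrightarrow> eventually (\<lambda>n. X n = Y n) \<U>"
proof -
  have mem: "Z \<in> cls \<U> W \<longleftrightarrow> eventually (\<lambda>n. Z n = W n) \<U>" for Z W
  proof
    assume "Z \<in> cls \<U> W"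
    then show "eventually (\<lambda>n. Z n = W n) \<U>"
      by (auto simp: cls_def a_r_coset_def' null_seqs_def seq_ring_def elim: eventually_mono)
  next
    assume "eventually (\<lambda>n. Z n = W n) \<U>"
    then have "(\<lambda>n. Z n - W n) \<in> null_seqs \<U>"
      by (auto simp: null_seqs_def elim: eventually_mono)
    then show "Z \<in> cls \<U> W"
      by (auto simp: cls_def a_r_coset_def' seq_ring_def intro!: bexI[of _ "\<lambda>n. Z n - W n"])
  qed
  show ?thesis
  proof
    assume "cls \<U> X = cls \<U> Y"
    moreover have "X \<in> cls \<U> X" by (simp add: mem)
    ultimately show "eventually (\<lambda>n. X n = Y n) \<U>" by (simp add: mem)
  next
    assume "eventually (\<lambda>n. X n = Y n) \<U>"
    then have "eventually (\<lambda>n. Z n = X n) \<U> \<longleftrightarrow> eventually (\<lambda>n. Z n = Y n) \<U>" for Z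
      by (rule eventually_cong) simp
    then show "cls \<U> X = cls \<U> Y"
      by (auto simp: mem)
  qed
qed

lemma vcls_eq_iff:
  fixes X Y :: "nat \<Rightarrow> real^'k"
  shows "vcls \<U> X = vcls \<U> Y \<longleftrightarrow> eventually (\<lambda>n. X n = Y n) \<U>"
  using eventually_ball_finite_distrib[of "UNIV :: 'k set" "\<lambda>n i. X n $ i = Y n $ i" \<U>]
  by (simp add: vcls_def vec_eq_iff cls_eq_iff)

lemma ring_hom_cls: "ring_hom_ring seq_ring (star_real \<U>) (cls \<U>)"
  unfolding star_real_def cls_def by (rule ideal.rcos_ring_hom_ring[OF ideal_null_seqs])

lemma cls_in_carrier: "cls \<U> X \<in> carrier (star_real \<U>)"
  using ring_hom_ring.homh[OF ring_hom_cls[of \<U>]] by (auto simp: ring_hom_def seq_ring_def)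

lemma carrier_star_realE:
  assumes "a \<in> carrier (star_real \<U>)"
  obtains X where "a = cls \<U> X"
  using assms
  by (auto simp: star_real_def FactRing_def A_RCOSETS_def' cls_def)

lemma cls_add: "cls \<U> X \<oplus>\<^bsub>star_real \<U>\<^esub> cls \<U> Y = cls \<U> (\<lambda>n. X n + Y n)"
  using ring_hom_ring.homh[OF ring_hom_cls[of \<U>]] by (auto simp: ring_hom_def seq_ring_def)

lemma cls_mult: "cls \<U> X \<otimes>\<^bsub>star_real \<U>\<^esub> cls \<U> Y = cls \<U> (\<lambda>n. X n * Y n)"
  using ring_hom_ring.homh[OF ring_hom_cls[of \<U>]] by (auto simp: ring_hom_def seq_ring_def)

lemma cls_one: "\<one>\<^bsub>star_real \<U>\<^esub> = cls \<U> (\<lambda>n. 1)"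
  using ring_hom_ring.homh[OF ring_hom_cls[of \<U>]] by (auto simp: ring_hom_def seq_ring_def)

lemma cls_diff: "cls \<U> X \<ominus>\<^bsub>star_real \<U>\<^esub> cls \<U> Y = cls \<U> (\<lambda>n. X n - Y n)"
proof -
  interpret cring "star_real \<U>" by (rule cring_star_real)
  have "cls \<U> X = cls \<U> (\<lambda>n. X n - Y n) \<oplus>\<^bsub>star_real \<U>\<^esub> cls \<U> Y"
    by (simp add: cls_add)
  then show ?thesis
    by (simp add: minus_eq a_assoc r_neg cls_in_carrier)
qed

lemma cls_sum:
  assumes "finite A"
  shows "(\<Oplus>\<^bsub>star_real \<U>\<^esub>i\<in>A. cls \<U> (X i)) = cls \<U> (\<lambda>n. \<Sum>i\<in>A. X i n)"
  using assms
proof induction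
  case empty
  interpret cring "star_real \<U>" by (rule cring_star_real)
  have "cls \<U> (\<lambda>n. 0) = \<zero>\<^bsub>star_real \<U>\<^esub>"
    using cls_diff[of \<U> "\<lambda>n. 0" "\<lambda>n. 0"] by (simp add: minus_eq r_neg cls_in_carrier)
  then show ?case by simp
next
  case (insert a A)
  interpret cring "star_real \<U>" by (rule cring_star_real)
  show ?case
    using insert by (simp add: finsum_insert cls_in_carrier cls_add Pi_def)
qed

lemma star_le_cls_iff: "star_le \<U> (cls \<U> X) (cls \<U> Y) \<longleftrightarrow> eventually (\<lambda>n. X n \<le> Y n) \<U>"
proof
  assume "star_le \<U> (cls \<U> X) (cls \<U> Y)"
  then obtain X' Y' where "eventually (\<lambda>n. X n = X' n) \<U>" "eventually (\<lambda>n. Y n = Y' n) \<U>"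
      "eventually (\<lambda>n. X' n \<le> Y' n) \<U>"
    by (auto simp: star_le_def cls_eq_iff)
  then show "eventually (\<lambda>n. X n \<le> Y n) \<U>"
    by eventually_elim simp
qed (auto simp: star_le_def)

lemma vdiff_vcls: "vdiff \<U> (vcls \<U> X) (vcls \<U> Y) = vcls \<U> (\<lambda>n. X n - Y n)"
  by (simp add: vdiff_def vcls_def cls_diff)

lemma vdot_vcls: "vdot \<U> (vcls \<U> X) (vcls \<U> Y) = cls \<U> (\<lambda>n. X n \<bullet> Y n)"
  by (simp add: vdot_def vcls_def cls_mult cls_sum inner_vec_def)

lemma segment_pt_vcls:
  "segment_pt \<U> (vcls \<U> X) (vcls \<U> Y) (cls \<U> T) =
     vcls \<U> (\<lambda>n. (1 - T n) *\<^sub>R X n + T n *\<^sub>R Y n)"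
  by (simp add: segment_pt_def vadd_def vscale_def vcls_def cls_one cls_diff cls_mult cls_add)

lemma internal_vecE:
  assumes "x \<in> internal_vec \<U> V"
  obtains X where "x = vcls \<U> X" "\<And>n. X n \<in> V n"
  using assms by (auto simp: internal_vec_def)

section \<open>From nonstandard points to their components\<close>

text \<open>A net has to lie in \<open>V n\<close> for every index to witness membership; given one net that
  does, any net that lies in the \<open>V n\<close> almost everywhere can be corrected to one that does
  so everywhere.\<close>

lemma internal_vec_correct:
  assumes "\<And>n. X n \<in> V n" and "eventually (\<lambda>n. Z n \<in> V n) \<U>"
  obtains Z' where "\<And>n. Z' n \<in> V n" "eventually (\<lambda>n. Z' n = Z n) \<U>" "vcls \<U> Z' = vcls \<U> Z"
proof
  let ?Z' = "\<lambda>n. if Z n \<in> V n then Z n else X n"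
  show "?Z' n \<in> V n" for n using assms(1) by simp
  show *: "eventually (\<lambda>n. ?Z' n = Z n) \<U>" using assms(2) by eventually_elim simp
  show "vcls \<U> ?Z' = vcls \<U> Z" using * by (simp only: vcls_eq_iff)
qed

text \<open>The universal case of Los's theorem: at each index where the statement fails, choose a
  counterexample; along the resulting sequence the statement holds almost everywhere.
  This turns hypotheses on nonstandard points into uniform statements on the components.\<close>

lemma eventually_all_of_sequences:
  assumes "\<And>Y. eventually (\<lambda>n. P n (Y n)) F"
  shows "eventually (\<lambda>n. \<forall>y. P n y) F"
  using assms[of "\<lambda>n. SOME y. \<not> P n y"]
  by (rule eventually_mono) (metis (mono_tags, lifting) someI_ex)

text \<open>A net of parameters at which the real segments leave \<open>V n\<close> would be a nonstandard parameter
  at which the nonstandard segment leaves \<open>[V n]\<close>.\<close>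

lemma eventually_segment_subset:
  assumes seg: "\<And>t. t \<in> star_set \<U> {0..1} \<Longrightarrow>
      segment_pt \<U> (vcls \<U> X) (vcls \<U> Y) t \<in> internal_vec \<U> V"
  shows "eventually (\<lambda>n. closed_segment (X n) (Y n) \<subseteq> V n) \<U>"
proof -
  have "eventually (\<lambda>n. \<forall>t. t \<in> {0..1} \<longrightarrow> (1 - t) *\<^sub>R X n + t *\<^sub>R Y n \<in> V n) \<U>"
  proof (rule eventually_all_of_sequences)
    fix T :: "nat \<Rightarrow> real"
    \<comment> \<open>Outside the unit interval nothing is claimed, so \<open>T\<close> may be moved back into it.\<close>
    define T' where "T' n = (if T n \<in> {0..1} then T n else 0)" for n
    have "cls \<U> T' \<in> star_set \<U> {0..1}"
      by (auto simp: star_set_def internal_def T'_def)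
    from seg[OF this]
    have "vcls \<U> (\<lambda>n. (1 - T' n) *\<^sub>R X n + T' n *\<^sub>R Y n) \<in> internal_vec \<U> V"
      by (simp add: segment_pt_vcls)
    then obtain Z where
      "vcls \<U> (\<lambda>n. (1 - T' n) *\<^sub>R X n + T' n *\<^sub>R Y n) = vcls \<U> Z" "\<And>n. Z n \<in> V n"
      unfolding internal_vec_def by blast
    then have "eventually (\<lambda>n. (1 - T' n) *\<^sub>R X n + T' n *\<^sub>R Y n \<in> V n) \<U>"
      unfolding vcls_eq_iff by (auto elim: eventually_mono)
    then show "eventually (\<lambda>n. T n \<in> {0..1} \<longrightarrow> (1 - T n) *\<^sub>R X n + T n *\<^sub>R Y n \<in> V n) \<U>"
      by eventually_elim (auto simp: T'_def)
  qed
  then show ?thesis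
    by eventually_elim (auto simp: closed_segment_def)
qed

section \<open>Independence of the gradient from the representing net\<close>

text \<open>Equality of \<open>g n\<close> and \<open>h n\<close> along every single net in the overlaps is known, as both sides
  represent the value of \<open>f\<close> there; choosing points of disagreement makes it
  uniform.\<close>

lemma smooth_rep_eventually_eq:
  assumes V: "smooth_rep \<U> f V g" and U: "smooth_rep \<U> f U h"
    and X: "\<And>n. X n \<in> V n" and Z: "\<And>n. Z n \<in> U n" and XZ: "vcls \<U> X = vcls \<U> Z"
  shows "eventually (\<lambda>n. \<forall>y \<in> V n \<inter> U n. g n y = h n y) \<U>"
  unfolding Ball_def
proof (rule eventually_all_of_sequences)
  fix Y :: "nat \<Rightarrow> real^'a"
  \<comment> \<open>Off the intersection, \<open>Y\<close> is replaced by representatives of the common base point, so that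
    both nets stay inside their domains and still define the same point.\<close>
  define Y\<^sub>V where "Y\<^sub>V n = (if Y n \<in> V n \<inter> U n then Y n else X n)" for n
  define Y\<^sub>U where "Y\<^sub>U n = (if Y n \<in> V n \<inter> U n then Y n else Z n)" for n
  have "vcls \<U> Y\<^sub>V = vcls \<U> Y\<^sub>U"
    using XZ unfolding vcls_eq_iff by eventually_elim (simp add: Y\<^sub>V_def Y\<^sub>U_def)
  moreover have "f (vcls \<U> Y\<^sub>V) = cls \<U> (\<lambda>n. g n (Y\<^sub>V n))"
    using V X by (simp add: smooth_rep_def Y\<^sub>V_def)
  moreover have "f (vcls \<U> Y\<^sub>U) = cls \<U> (\<lambda>n. h n (Y\<^sub>U n))"
    using U Z by (simp add: smooth_rep_def Y\<^sub>U_def)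
  ultimately have "eventually (\<lambda>n. g n (Y\<^sub>V n) = h n (Y\<^sub>U n)) \<U>"
    by (metis cls_eq_iff)
  then show "eventually (\<lambda>n. Y n \<in> V n \<inter> U n \<longrightarrow> g n (Y n) = h n (Y n)) \<U>"
    by eventually_elim (auto simp: Y\<^sub>V_def Y\<^sub>U_def)
qed

lemma partial_cong_open:
  assumes "open S" "x \<in> S" and eq: "\<And>y. y \<in> S \<Longrightarrow> g y = h y"
  shows "partial i g x = partial i h x"
  unfolding partial_def
proof (rule deriv_cong_ev)
  have "((\<lambda>t::real. x + t *\<^sub>R axis i 1) \<longlongrightarrow> x + 0 *\<^sub>R axis i 1) (nhds 0)"
    by (intro tendsto_intros filterlim_ident)
  then have "eventually (\<lambda>t::real. x + t *\<^sub>R axis i 1 \<in> S) (nhds 0)"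
    using assms(1,2) by (auto dest: topological_tendstoD)
  then show "eventually (\<lambda>t::real. g (x + t *\<^sub>R axis i 1) = h (x + t *\<^sub>R axis i 1)) (nhds 0)"
    by eventually_elim (rule eq)
qed simp

text \<open>The description that defines \<open>star_partial\<close> is satisfied by the value computed from the
  global representation, and by no other: at almost every index, \<open>g n\<close> and \<open>h n\<close> agree on the
  open overlap, which contains the base point, and a partial derivative depends only on the
  germ.\<close>

lemma star_grad_eq:
  assumes rep: "smooth_rep \<U> f U h" and Z: "\<And>n. Z n \<in> U n"
  shows "star_grad \<U> (internal_vec \<U> U) f (vcls \<U> Z) = vcls \<U> (\<lambda>n. \<chi> i. partial i (h n) (Z n))"
proof -
  have "star_partial \<U> (internal_vec \<U> U) i f (vcls \<U> Z) = cls \<U> (\<lambda>n. partial i (h n) (Z n))" for i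
    unfolding star_partial_def
  proof (rule the_equality)
    show "\<exists>V g X. internal_vec \<U> V \<subseteq> internal_vec \<U> U \<and> smooth_rep \<U> f V g \<and>
        (\<forall>n. X n \<in> V n) \<and> vcls \<U> Z = vcls \<U> X \<and>
        cls \<U> (\<lambda>n. partial i (h n) (Z n)) = cls \<U> (\<lambda>n. partial i (g n) (X n))"
      using assms by blast
  next
    fix d
    assume "\<exists>V g X. internal_vec \<U> V \<subseteq> internal_vec \<U> U \<and> smooth_rep \<U> f V g \<and>
        (\<forall>n. X n \<in> V n) \<and> vcls \<U> Z = vcls \<U> X \<and> d = cls \<U> (\<lambda>n. partial i (g n) (X n))"
    then obtain V g X where V: "smooth_rep \<U> f V g" and X: "\<And>n. X n \<in> V n"
      and XZ: "vcls \<U> X = vcls \<U> Z" and d: "d = cls \<U> (\<lambda>n. partial i (g n) (X n))"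
      by metis
    have "eventually (\<lambda>n. partial i (g n) (X n) = partial i (h n) (Z n)) \<U>"
      using smooth_rep_eventually_eq[OF V rep X Z XZ] XZ[unfolded vcls_eq_iff]
    proof eventually_elim
      case (elim n)
      have "open (V n \<inter> U n)" "X n \<in> V n \<inter> U n"
        using V rep X[of n] Z[of n] elim by (auto simp: smooth_rep_def)
      then show ?case
        using partial_cong_open[of "V n \<inter> U n" "X n" "g n" "h n" i] elim by simp
    qed
    then show "d = cls \<U> (\<lambda>n. partial i (h n) (Z n))"
      unfolding d cls_eq_iff .
  qed
  then show ?thesis by (simp add: star_grad_def vcls_def)
qed

section \<open>The intermediate and mean value theorems on a segment\<close>

lemma smooth_on_imp_differentiable_at:
  assumes "smooth_on S g" "open S" "p \<in> S"
  shows "g differentiable (at p)"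
proof -
  have "C_on (Suc 0) S g" using assms(1) unfolding smooth_on_def by blast
  then show ?thesis using assms(2,3) by (auto simp: differentiable_on_eq_differentiable_at)
qed

lemma partial_eq_derivative:
  assumes "(g has_derivative g') (at p)"
  shows "partial i g p = g' (axis i 1)"
proof -
  have "((\<lambda>t::real. p + t *\<^sub>R axis i 1) has_derivative (\<lambda>t. t *\<^sub>R axis i 1)) (at 0)"
    by (auto intro!: derivative_eq_intros)
  then have "((\<lambda>t. g (p + t *\<^sub>R axis i 1)) has_derivative (\<lambda>t. g' (t *\<^sub>R axis i 1))) (at 0)"
    using has_derivative_compose[of "\<lambda>t. p + t *\<^sub>R axis i 1" _ 0 UNIV g g'] assms by simp
  then have "((\<lambda>t. g (p + t *\<^sub>R axis i 1)) has_real_derivative g' (axis i 1)) (at 0)"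
    using linear_scale[OF has_derivative_linear[OF assms]]
    by (simp add: has_field_derivative_def mult.commute[of _ "g' (axis i 1)"] fun_eq_iff)
  then show ?thesis unfolding partial_def by (rule DERIV_imp_deriv)
qed

text \<open>This connects the derivative supplied by the chain rule with the coordinate-wise gradient
  of the nonstandard theory.\<close>

lemma derivative_eq_gradient_inner:
  fixes g :: "real^'k \<Rightarrow> real"
  assumes "(g has_derivative g') (at p)"
  shows "g' v = (\<chi> i. partial i g p) \<bullet> v"
proof -
  have lin: "linear g'" by (rule has_derivative_linear[OF assms])
  have "g' v = g' (\<Sum>i\<in>UNIV. (v $ i) *\<^sub>R axis i 1)"
    by (simp add: basis_expansion[of v, unfolded scalar_mult_eq_scaleR])
  also have "\<dots> = (\<Sum>i\<in>UNIV. v $ i * g' (axis i 1))"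
    by (simp add: linear_sum[OF lin] linear_scale[OF lin])
  finally show ?thesis
    by (simp add: inner_vec_def partial_eq_derivative[OF assms] mult.commute)
qed

lemma segment_MVT:
  fixes g :: "real^'k \<Rightarrow> real"
  assumes diff: "\<And>p. p \<in> closed_segment a b \<Longrightarrow> g differentiable (at p)"
  shows "\<exists>c\<in>{0<..<1}. g b - g a = (\<chi> i. partial i g ((1 - c) *\<^sub>R a + c *\<^sub>R b)) \<bullet> (b - a)"
proof -
  define \<gamma> where "\<gamma> t = (1 - t) *\<^sub>R a + t *\<^sub>R b" for t :: real
  have der: "((\<lambda>t. g (\<gamma> t)) has_derivative (\<lambda>s. s * ((\<chi> i. partial i g (\<gamma> t)) \<bullet> (b - a)))) (at t)"
    if "0 \<le> t" "t \<le> 1" for t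
  proof -
    have "\<gamma> t \<in> closed_segment a b" using that by (auto simp: closed_segment_def \<gamma>_def)
    then obtain g' where g': "(g has_derivative g') (at (\<gamma> t))"
      using diff by (auto simp: differentiable_def)
    have "(\<gamma> has_derivative (\<lambda>s. s *\<^sub>R (b - a))) (at t)"
      unfolding \<gamma>_def by (auto intro!: derivative_eq_intros simp: algebra_simps)
    then have "((\<lambda>t. g (\<gamma> t)) has_derivative (\<lambda>s. g' (s *\<^sub>R (b - a)))) (at t)"
      using has_derivative_compose[of \<gamma> _ t UNIV g g'] g' by simp
    then show ?thesis
      by (simp add: derivative_eq_gradient_inner[OF g'])
  qed
  obtain c where "c \<in> {0<..<1}" "g (\<gamma> 1) - g (\<gamma> 0) = (1 - 0) * ((\<chi> i. partial i g (\<gamma> c)) \<bullet> (b - a))"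
    using mvt_simple[of 0 1 "\<lambda>t. g (\<gamma> t)" "\<lambda>t s. s * ((\<chi> i. partial i g (\<gamma> t)) \<bullet> (b - a))"]
      der[THEN has_derivative_at_withinI] by auto
  then show ?thesis by (auto simp: \<gamma>_def)
qed

lemma segment_IVT:
  fixes g :: "real^'k \<Rightarrow> real"
  assumes "continuous_on (closed_segment a b) g"
    and r: "r \<in> closed_segment (g a) (g b)"
  shows "\<exists>p\<in>closed_segment a b. g p = r"
proof -
  have "is_interval (g ` closed_segment a b)"
    using connected_continuous_image[OF assms(1)] by (simp add: is_interval_connected_1)
  then have "closed_segment (g a) (g b) \<subseteq> g ` closed_segment a b"
    by (intro closed_segment_subset) (auto simp: is_interval_convex)
  then show ?thesis using r by auto
qed

section \<open>Transfer to nonstandard points\<close>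

theorem proposition3p9:
  fixes \<U> :: "nat filter"
    and U\<^sub>n :: "nat \<Rightarrow> (real^'k) set"
    and U :: "(hyperreal^'k) set"
    and f :: "hyperreal^'k \<Rightarrow> hyperreal"
    and f\<^sub>n :: "nat \<Rightarrow> real^'k \<Rightarrow> real"
    and x y :: "hyperreal^'k"
  assumes "free_ultrafilter \<U>"
    and "\<And>n. open (U\<^sub>n n)"
    and "U = internal_vec \<U> U\<^sub>n"
    and "f \<in> star_smooth \<U> U"
    and "\<And>n. smooth_on (U\<^sub>n n) (f\<^sub>n n)"
    and "\<And>z. (\<And>n. z n \<in> U\<^sub>n n) \<Longrightarrow> f (vcls \<U> z) = cls \<U> (\<lambda>n. f\<^sub>n n (z n))"
    and "x \<in> U" and "y \<in> U"
    and "\<And>t. t \<in> star_set \<U> {0..1} \<Longrightarrow> segment_pt \<U> x y t \<in> U"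
  shows "(f x \<noteq> f y \<longrightarrow>
           (\<forall>r\<in>carrier (star_real \<U>).
              star_le \<U> (f x) r \<and> star_le \<U> r (f y) \<or>
              star_le \<U> (f y) r \<and> star_le \<U> r (f x) \<longrightarrow>
              (\<exists>z\<in>U. f z = r))) \<and>
         (\<exists>c\<in>star_set \<U> {0<..<1}.
            f y \<ominus>\<^bsub>star_real \<U>\<^esub> f x =
            vdot \<U> (star_grad \<U> U f (segment_pt \<U> x y c)) (vdiff \<U> y x))"
proof (intro conjI impI ballI)
  have rep: "smooth_rep \<U> f U\<^sub>n f\<^sub>n"
    using assms(2,5,6) by (auto simp: smooth_rep_def)
  obtain X where x: "x = vcls \<U> X" and X: "\<And>n. X n \<in> U\<^sub>n n"
    using assms(3,7) by (auto elim: internal_vecE)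
  obtain Y where y: "y = vcls \<U> Y" and Y: "\<And>n. Y n \<in> U\<^sub>n n"
    using assms(3,8) by (auto elim: internal_vecE)
  have fx: "f x = cls \<U> (\<lambda>n. f\<^sub>n n (X n))" and fy: "f y = cls \<U> (\<lambda>n. f\<^sub>n n (Y n))"
    using assms(6) X Y x y by auto
  have seg: "eventually (\<lambda>n. closed_segment (X n) (Y n) \<subseteq> U\<^sub>n n) \<U>"
    by (rule eventually_segment_subset) (use assms(3,9) x y in simp)
  have diff: "f\<^sub>n n differentiable (at p)" if "p \<in> U\<^sub>n n" for n p
    using smooth_on_imp_differentiable_at[OF assms(5) assms(2) that] .

  show "\<exists>z\<in>U. f z = r"
    if "r \<in> carrier (star_real \<U>)"
      and between: "star_le \<U> (f x) r \<and> star_le \<U> r (f y) \<or> star_le \<U> (f y) r \<and> star_le \<U> r (f x)"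
    for r
  proof -
    obtain R where R: "r = cls \<U> R"
      using \<open>r \<in> carrier (star_real \<U>)\<close> by (rule carrier_star_realE)
    have "eventually (\<lambda>n. R n \<in> closed_segment (f\<^sub>n n (X n)) (f\<^sub>n n (Y n))) \<U>"
      using between unfolding fx fy R star_le_cls_iff
      by (auto simp: closed_segment_eq_real_ivl elim: eventually_elim2)
    then have "eventually (\<lambda>n. \<exists>p. p \<in> U\<^sub>n n \<and> f\<^sub>n n p = R n) \<U>"
      using seg
    proof eventually_elim
      case (elim n)
      have "continuous_on (closed_segment (X n) (Y n)) (f\<^sub>n n)"
        using elim(2) diff
        by (auto intro!: continuous_at_imp_continuous_on differentiable_imp_continuous_within)
      from segment_IVT[OF this elim(1)] elim(2) show ?case by auto
    qed
    then obtain Z where Z: "eventually (\<lambda>n. Z n \<in> U\<^sub>n n \<and> f\<^sub>n n (Z n) = R n) \<U>"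
      unfolding eventually_ex by blast
    then have "eventually (\<lambda>n. Z n \<in> U\<^sub>n n) \<U>"
      by (auto elim: eventually_mono)
    then obtain Z' where Z': "\<And>n. Z' n \<in> U\<^sub>n n" and ZZ': "eventually (\<lambda>n. Z' n = Z n) \<U>"
      using internal_vec_correct[of X U\<^sub>n Z \<U>] X by metis
    have "eventually (\<lambda>n. f\<^sub>n n (Z' n) = R n) \<U>"
      using Z ZZ' by eventually_elim simp
    then have "f (vcls \<U> Z') = r"
      using assms(6) Z' by (simp add: R cls_eq_iff)
    moreover have "vcls \<U> Z' \<in> U"
      using Z' by (auto simp: assms(3) internal_vec_def)
    ultimately show ?thesis by blast
  qed

  show "\<exists>c\<in>star_set \<U> {0<..<1}. f y \<ominus>\<^bsub>star_real \<U>\<^esub> f x =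
      vdot \<U> (star_grad \<U> U f (segment_pt \<U> x y c)) (vdiff \<U> y x)"
  proof -
    define mean where "mean n c \<longleftrightarrow> c \<in> {0<..<1} \<and> f\<^sub>n n (Y n) - f\<^sub>n n (X n) =
        (\<chi> i. partial i (f\<^sub>n n) ((1 - c) *\<^sub>R X n + c *\<^sub>R Y n)) \<bullet> (Y n - X n)" for n c
    have "eventually (\<lambda>n. \<exists>c. mean n c) \<U>"
      using seg
    proof eventually_elim
      case (elim n)
      then have "\<And>p. p \<in> closed_segment (X n) (Y n) \<Longrightarrow> f\<^sub>n n differentiable (at p)"
        using diff by blast
      then show ?case
        using segment_MVT[of "X n" "Y n" "f\<^sub>n n"] unfolding mean_def by blast
    qed
    then obtain C\<^sub>0 where C\<^sub>0: "eventually (\<lambda>n. mean n (C\<^sub>0 n)) \<U>"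
      unfolding eventually_ex by blast
    \<comment> \<open>Any value in the open interval serves as default on the negligible set of indices.\<close>
    define C where "C n = (if C\<^sub>0 n \<in> {0<..<1} then C\<^sub>0 n else 1/2)" for n
    have C01: "C n \<in> {0<..<1}" for n by (simp add: C_def)
    have C: "eventually (\<lambda>n. mean n (C n)) \<U>"
      using C\<^sub>0 by eventually_elim (simp add: C_def mean_def)
    define W where "W n = (1 - C n) *\<^sub>R X n + C n *\<^sub>R Y n" for n
    have "eventually (\<lambda>n. W n \<in> U\<^sub>n n) \<U>"
      using seg
    proof eventually_elim
      case (elim n)
      have "W n \<in> closed_segment (X n) (Y n)"
        using C01[of n] by (auto simp: closed_segment_def W_def intro!: exI[of _ "C n"])
      then show ?case using elim by blast
    qed
    then obtain Z where Z: "\<And>n. Z n \<in> U\<^sub>n n" and ZW: "eventually (\<lambda>n. Z n = W n) \<U>"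
        "vcls \<U> Z = vcls \<U> W"
      using internal_vec_correct[of X U\<^sub>n W \<U>] X by metis
    have pt: "segment_pt \<U> x y (cls \<U> C) = vcls \<U> Z"
      unfolding x y segment_pt_vcls ZW(2) W_def ..
    have "eventually (\<lambda>n. f\<^sub>n n (Y n) - f\<^sub>n n (X n) =
        (\<chi> i. partial i (f\<^sub>n n) (Z n)) \<bullet> (Y n - X n)) \<U>"
      using C ZW(1) by eventually_elim (simp add: mean_def W_def)
    then have "f y \<ominus>\<^bsub>star_real \<U>\<^esub> f x =
        vdot \<U> (vcls \<U> (\<lambda>n. \<chi> i. partial i (f\<^sub>n n) (Z n))) (vdiff \<U> y x)"
      unfolding fx fy cls_diff unfolding x y vdiff_vcls vdot_vcls cls_eq_iff .
    then have "f y \<ominus>\<^bsub>star_real \<U>\<^esub> f x =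
        vdot \<U> (star_grad \<U> U f (segment_pt \<U> x y (cls \<U> C))) (vdiff \<U> y x)"
      unfolding pt assms(3) star_grad_eq[OF rep Z] .
    moreover have "cls \<U> C \<in> star_set \<U> {0<..<1}"
      using C01 by (auto simp: star_set_def internal_def)
    ultimately show ?thesis by blast
  qed
qed

end
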